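(* Every modular consecutive Latin square of order $n>4$ is either left-cyclic or right-cyclic.
   Context: A Latin square of order $n$ is an $n\times n$ table filled with the integers $1,\dots,n$ so that each integer appears exactly once in each row and in each column. A modular consecutive Latin square of order $n>2$ is a Latin square in which any two orthogonally adjacent cells (horizontal or vertical neighbors, no wrap-around) contain numbers that are consecutive modulo $n$, i.e. they differ by exactly $1$ or they are $1$ and $n$. A Latin square is left-cyclic if each subsequent row is the left cyclic shift by one of the previous row, and right-cyclic if each subsequent row is the right cyclic shift by one of the previous row. *)

theory Defs
  imports Main
begin

(* An n x n table is a function L, with L i j the entry in row i and column j.
   Rows and columns are numbered 0, ..., n - 1; the entries are 1, ..., n.
   Values of L outside this range are irrelevant. *)

definition latin_square :: "nat \<Rightarrow> (nat \<Rightarrow> nat \<Rightarrow> nat) \<Rightarrow> bool" where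
  "latin_square n L \<longleftrightarrow>
     (\<forall>i<n. \<forall>j<n. L i j \<in> {1..n}) \<and>
     (\<forall>i<n. \<forall>k\<in>{1..n}. \<exists>!j. j < n \<and> L i j = k) \<and>
     (\<forall>j<n. \<forall>k\<in>{1..n}. \<exists>!i. i < n \<and> L i j = k)"

definition consecutive_mod :: "nat \<Rightarrow> nat \<Rightarrow> nat \<Rightarrow> bool" where
  "consecutive_mod n a b \<longleftrightarrow> a = b + 1 \<or> b = a + 1 \<or> {a, b} = {1, n}"

definition modular_consecutive_latin_square :: "nat \<Rightarrow> (nat \<Rightarrow> nat \<Rightarrow> nat) \<Rightarrow> bool" where
  "modular_consecutive_latin_square n L \<longleftrightarrow>
     n > 2 \<and> latin_square n L \<and>
     (\<forall>i<n. \<forall>j. j + 1 < n \<longrightarrow> consecutive_mod n (L i j) (L i (j + 1))) \<and>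
     (\<forall>i. \<forall>j<n. i + 1 < n \<longrightarrow> consecutive_mod n (L i j) (L (i + 1) j))"

(* The left shift of (a_0, ..., a_(n-1)) is (a_1, ..., a_(n-1), a_0);
   the right shift is (a_(n-1), a_0, ..., a_(n-2)). *)

definition left_cyclic :: "nat \<Rightarrow> (nat \<Rightarrow> nat \<Rightarrow> nat) \<Rightarrow> bool" where
  "left_cyclic n L \<longleftrightarrow> (\<forall>i. \<forall>j<n. i + 1 < n \<longrightarrow> L (i + 1) j = L i ((j + 1) mod n))"

definition right_cyclic :: "nat \<Rightarrow> (nat \<Rightarrow> nat \<Rightarrow> nat) \<Rightarrow> bool" where
  "right_cyclic n L \<longleftrightarrow> (\<forall>i. \<forall>j<n. i + 1 < n \<longrightarrow> L (i + 1) ((j + 1) mod n) = L i j)"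

end

theory Submission
  imports Defs
begin

text \<open>Work modulo \<open>n\<close>. A row changes by \<open>\<plusminus>1\<close> at each step and cannot turn back without repeating a
  number, so row \<open>i\<close> is an arithmetic progression with difference \<open>s\<^sub>i = \<plusminus>1\<close>; the same holds for
  columns. If \<open>s\<^sub>i\<^sub>+\<^sub>1 = - s\<^sub>i\<close>, then the differences of rows \<open>i + 1\<close> and \<open>i\<close> in three successive columns
  have the form \<open>c\<close>, \<open>c + 2e\<close>, \<open>c + 4e\<close> with \<open>e = \<plusminus>1\<close>; for \<open>n > 4\<close> these are distinct residues and
  cannot all be \<open>\<plusminus>1\<close>. Hence all \<open>s\<^sub>i\<close> equal some \<open>s\<close>, and the square is \<open>a + s j + t i\<close> with
  \<open>t = \<plusminus>1\<close>: left-cyclic if \<open>t = s\<close>, right-cyclic if \<open>t = - s\<close>.\<close>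

text \<open>The wrap-around neighbors fit the same pattern: going from \<open>1\<close> to
  \<open>n\<close> is a step of \<open>-1\<close> modulo \<open>n\<close>, from \<open>n\<close> to
  \<open>1\<close> a step of \<open>1\<close>.\<close>

lemma consecutive_mod_imp_dvd:
  assumes "consecutive_mod n a b"
  shows "\<exists>s\<in>{1, -1}. int n dvd int b - int a - s"
proof -
  consider "a = b + 1" | "b = a + 1" | "a = 1" "b = n" | "a = n" "b = 1"
    using assms unfolding consecutive_mod_def doubleton_eq_iff by blast
  then show ?thesis
    by cases auto
qed

lemma dvd_diff_imp_eq:
  assumes "a \<in> {1..n}" "b \<in> {1..n}" "int n dvd int a - int b"
  shows "a = b"
proof -
  have "\<bar>int a - int b\<bar> < int n"
    using assms(1,2) by auto
  then have "int a - int b = 0"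
    using assms(3) zdvd_not_zless[of "\<bar>int a - int b\<bar>" "int n"] by auto
  then show ?thesis by simp
qed

text \<open>Two successive steps of opposite sign would give \<open>f (j + 2)\<close> and
  \<open>f j\<close> the same residue, against injectivity. Being about an arbitrary integer
  sequence, this serves rows and columns alike.\<close>

lemma unit_steps_arithmetic:
  fixes f :: "nat \<Rightarrow> int"
  assumes step: "\<And>j. j + 1 < n \<Longrightarrow> \<exists>s\<in>{1, -1}. int n dvd f (j + 1) - f j - s"
    and inj: "\<And>j k. j < n \<Longrightarrow> k < n \<Longrightarrow> int n dvd f j - f k \<Longrightarrow> j = k"
  shows "\<exists>s\<in>{1, -1}. \<forall>j<n. int n dvd f j - f 0 - s * int j"
proof (cases "1 < n")
  \<comment> \<open>There is no first step to supply \<open>s\<close> here; either sign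
    works.\<close>
  case False
  then have "j = 0" if "j < n" for j using that by simp
  then show ?thesis by fastforce
next
  case True
  then have "\<exists>s\<in>{1, -1}. int n dvd f (0 + 1) - f 0 - s"
    by (intro step) simp
  then obtain s where s: "s \<in> {1, -1}" "int n dvd f (0 + 1) - f 0 - s"
    by blast
  have const: "int n dvd f (j + 1) - f j - s" if "j + 1 < n" for j
    using that
  proof (induction j)
    case 0
    show ?case by (fact s(2))
  next
    case (Suc j)
    obtain r where r: "r \<in> {1, -1}" "int n dvd f (Suc j + 1) - f (Suc j) - r"
      using step[OF Suc.prems] by blast
    have "r = s"
    proof (rule ccontr)
      assume "r \<noteq> s"
      then have "r = - s" using r(1) s(1) by auto
      then have "int n dvd f (Suc j + 1) - f j"
        using dvd_add[OF r(2) Suc.IH] Suc.prems by simp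
      then show False using inj[of "Suc j + 1" j] Suc.prems by simp
    qed
    then show ?case using r(2) by simp
  qed
  have "int n dvd f j - f 0 - s * int j" if "j < n" for j
    using that
  proof (induction j)
    case (Suc j)
    have "int n dvd (f (j + 1) - f j - s) + (f j - f 0 - s * int j)"
      using const[of j] Suc by (intro dvd_add) auto
    then show ?case by (simp add: algebra_simps)
  qed simp
  then show ?thesis using s(1) by blast
qed

text \<open>Subtracting neighboring congruences leaves numbers of absolute value at most 4, hence
  below \<open>n\<close>, so they vanish as integers. The first forces \<open>u1 = e\<close>, the
  second \<open>u1 = - e\<close>.\<close>

lemma opposite_directions_impossible:
  fixes n :: nat and c e :: int
  assumes n: "n > 4" and e: "e \<in> {1, -1}"
    and uc: "\<And>k::nat. k \<le> 2 \<Longrightarrow> \<exists>u\<in>{1, -1}. int n dvd c + 2 * e * int k - u"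
  shows False
proof -
  have small: "x = 0" if "int n dvd x" "\<bar>x\<bar> \<le> 4" for x :: int
    using that n zdvd_not_zless[of "\<bar>x\<bar>" "int n"] by auto
  have "\<exists>u\<in>{1, -1}. int n dvd c - u" "\<exists>u\<in>{1, -1}. int n dvd c + 2 * e - u"
    "\<exists>u\<in>{1, -1}. int n dvd c + 4 * e - u"
    using uc[of 0] uc[of 1] uc[of 2] by simp_all
  then obtain u0 u1 u2 where u: "u0 \<in> {1, -1}" "u1 \<in> {1, -1}" "u2 \<in> {1, -1}"
    and d: "int n dvd c - u0" "int n dvd c + 2 * e - u1" "int n dvd c + 4 * e - u2"
    by blast
  have "int n dvd 2 * e - u1 + u0"
    using dvd_diff[OF d(2) d(1)] by (simp add: algebra_simps)
  then have "2 * e - u1 + u0 = 0"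
    using e u by (intro small) auto
  moreover have "int n dvd 2 * e - u2 + u1"
    using dvd_diff[OF d(3) d(2)] by (simp add: algebra_simps)
  then have "2 * e - u2 + u1 = 0"
    using e u by (intro small) auto
  ultimately show False using e u by auto
qed

lemma modular_consecutive_latin_squareD:
  assumes "modular_consecutive_latin_square n L"
  shows "\<forall>i<n. \<forall>j<n. L i j \<in> {1..n}"
    and "\<forall>i<n. \<forall>k\<in>{1..n}. \<exists>!j. j < n \<and> L i j = k"
    and "\<forall>j<n. \<forall>k\<in>{1..n}. \<exists>!i. i < n \<and> L i j = k"
    and "\<forall>i<n. \<forall>j. j + 1 < n \<longrightarrow> consecutive_mod n (L i j) (L i (j + 1))"
    and "\<forall>i. \<forall>j<n. i + 1 < n \<longrightarrow> consecutive_mod n (L i j) (L (i + 1) j)"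
  using assms unfolding modular_consecutive_latin_square_def latin_square_def
  by - (elim conjE, assumption)+

lemma modular_consecutive_latin_square_affine:
  assumes n: "n > 4" and L: "modular_consecutive_latin_square n L"
  shows "\<exists>s\<in>{1, -1}. \<exists>t\<in>{1, -1}. \<forall>i<n. \<forall>j<n.
    int n dvd int (L i j) - int (L 0 0) - t * int i - s * int j"
proof -
  have range: "L i j \<in> {1..n}" if "i < n" "j < n" for i j
    using modular_consecutive_latin_squareD(1)[OF L] that by blast
  have row_inj: "j = k" if "i < n" "j < n" "k < n" "L i j = L i k" for i j k
  proof -
    have "\<exists>!m. m < n \<and> L i m = L i j"
      using modular_consecutive_latin_squareD(2)[OF L] range[of i j] that by blast
    then show ?thesis using that by auto
  qed
  have col_inj: "i = k" if "i < n" "j < n" "k < n" "L i j = L k j" for i j k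
  proof -
    have "\<exists>!m. m < n \<and> L m j = L i j"
      using modular_consecutive_latin_squareD(3)[OF L] range[of i j] that by blast
    then show ?thesis using that by auto
  qed
  have row_step: "\<exists>s\<in>{1, -1}. int n dvd int (L i (j + 1)) - int (L i j) - s"
    if "i < n" "j + 1 < n" for i j
    using modular_consecutive_latin_squareD(4)[OF L] that
    by (intro consecutive_mod_imp_dvd) blast
  have col_step: "\<exists>s\<in>{1, -1}. int n dvd int (L (i + 1) j) - int (L i j) - s"
    if "i + 1 < n" "j < n" for i j
    using modular_consecutive_latin_squareD(5)[OF L] that
    by (intro consecutive_mod_imp_dvd) blast

  let ?row = "\<lambda>i s. s \<in> {1, -1} \<and> (\<forall>j<n. int n dvd int (L i j) - int (L i 0) - s * int j)"
  have "\<exists>s\<in>{1, -1}. \<forall>j<n. int n dvd int (L i j) - int (L i 0) - s * int j" if "i < n" for i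
  proof (rule unit_steps_arithmetic[where f = "\<lambda>j. int (L i j)"])
    fix j k
    assume "j < n" "k < n" "int n dvd int (L i j) - int (L i k)"
    then show "j = k"
      using row_inj[OF that] dvd_diff_imp_eq[OF range[OF that] range[OF that]] by simp
  qed (rule row_step[OF that])
  then have "\<forall>i. \<exists>s. i < n \<longrightarrow> ?row i s"
    by blast
  then obtain s where "\<forall>i. i < n \<longrightarrow> ?row i (s i)"
    by (rule choice[THEN exE])
  then have s: "s i \<in> {1, -1}"
    and row: "j < n \<Longrightarrow> int n dvd int (L i j) - int (L i 0) - s i * int j" if "i < n" for i j
    using that by blast+
  \<comment> \<open>Column 0 fixes the starting points of all rows; the other columns enter below
    through \<open>col_step\<close>.\<close>
  have "\<exists>t\<in>{1, -1}. \<forall>i<n. int n dvd int (L i 0) - int (L 0 0) - t * int i"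
  proof (rule unit_steps_arithmetic[where f = "\<lambda>i. int (L i 0)"])
    fix i k
    assume "i < n" "k < n" "int n dvd int (L i 0) - int (L k 0)"
    then show "i = k"
      using n col_inj[of i 0 k] dvd_diff_imp_eq[OF range[of i 0] range[of k 0]] by simp
  qed (use col_step n in simp)
  then obtain t where t: "t \<in> {1, -1}"
    and col: "\<And>i. i < n \<Longrightarrow> int n dvd int (L i 0) - int (L 0 0) - t * int i"
    by blast

  have s_Suc: "s (i + 1) = s i" if i: "i + 1 < n" for i
  proof (rule ccontr)
    assume "s (i + 1) \<noteq> s i"
    then have opp: "s i = - s (i + 1)"
      using s[of i] s[of "i + 1"] i by auto
    show False
    proof (rule opposite_directions_impossible[OF n])
      show "s (i + 1) \<in> {1, -1}" using s i by blast
      fix k :: nat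
      assume "k \<le> 2"
      then have k: "k < n" using n by simp
      obtain u where u: "u \<in> {1, -1}" "int n dvd int (L (i + 1) k) - int (L i k) - u"
        using col_step[OF i k] by blast
      \<comment> \<open>The column-\<open>k\<close> entries cancel, and
        \<open>s i = - s (i + 1)\<close> doubles the coefficient of \<open>k\<close>.\<close>
      have "int n dvd (int (L (i + 1) k) - int (L i k) - u)
          - (int (L (i + 1) k) - int (L (i + 1) 0) - s (i + 1) * int k)
          + (int (L i k) - int (L i 0) - s i * int k)"
        by (rule dvd_add[OF dvd_diff[OF u(2) row[OF i k]] row[OF _ k]]) (use i in simp)
      then have "int n dvd (int (L (i + 1) 0) - int (L i 0)) + 2 * s (i + 1) * int k - u"
        by (simp add: opp algebra_simps)
      then show "\<exists>u\<in>{1, -1}.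
          int n dvd (int (L (i + 1) 0) - int (L i 0)) + 2 * s (i + 1) * int k - u"
        using u(1) by blast
    qed
  qed
  have s_const: "s i = s 0" if "i < n" for i
    using that
  proof (induction i)
    case (Suc i)
    then show ?case using s_Suc[of i] by simp
  qed simp
  have "int n dvd int (L i j) - int (L 0 0) - t * int i - s 0 * int j" if "i < n" "j < n" for i j
    using dvd_add[OF row[OF that] col[OF that(1)]] s_const[OF that(1)]
    by (simp add: algebra_simps)
  moreover have "s 0 \<in> {1, -1}" using s n by simp
  ultimately show ?thesis using t by blast
qed

theorem proposition6:
  fixes n :: nat and L :: "nat \<Rightarrow> nat \<Rightarrow> nat"
  assumes "n > 4"
    and "modular_consecutive_latin_square n L"
  shows "left_cyclic n L \<or> right_cyclic n L"
proof -
  obtain s t where st: "s \<in> {1, -1}" "t \<in> {1, -1}"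
    and aff: "\<And>i j. i < n \<Longrightarrow> j < n \<Longrightarrow>
      int n dvd int (L i j) - int (L 0 0) - t * int i - s * int j"
    using modular_consecutive_latin_square_affine[OF assms] by blast
  \<comment> \<open>The affine form fixes entries modulo \<open>n\<close>, and the range
    \<open>{1..n}\<close> turns congruence into equality.\<close>
  have eq: "L i j = L i' j'"
    if ij: "i < n" "j < n" "i' < n" "j' < n"
      and d: "int n dvd t * (int i - int i') + s * (int j - int j')" for i j i' j'
  proof (rule dvd_diff_imp_eq)
    show "L i j \<in> {1..n}" "L i' j' \<in> {1..n}"
      using modular_consecutive_latin_squareD(1)[OF assms(2)] ij by blast+
    show "int n dvd int (L i j) - int (L i' j')"
      using dvd_add[OF dvd_diff[OF aff[OF ij(1,2)] aff[OF ij(3,4)]] d]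
      by (simp add: algebra_simps)
  qed
  \<comment> \<open>Reducing the column index changes it by a multiple of \<open>n\<close>, so the
    last column needs no separate case.\<close>
  have wrap: "int n dvd int j + 1 - int ((j + 1) mod n)" for j
    using dvd_minus_mod[of "int n" "int j + 1"] by (simp add: zmod_int ac_simps)
  show ?thesis
  proof (cases "t = s")
    case True
    \<comment> \<open>One step down changes the residue exactly as one step right does.\<close>
    have "L (i + 1) j = L i ((j + 1) mod n)" if "i + 1 < n" "j < n" for i j
    proof (rule eq)
      show "int n dvd t * (int (i + 1) - int i) + s * (int j - int ((j + 1) mod n))"
        using dvd_mult[OF wrap[of j], of s] by (simp add: True algebra_simps)
    qed (use that in auto)
    then show ?thesis unfolding left_cyclic_def by blast
  next
    case False
    then have t: "t = - s" using st by auto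
    \<comment> \<open>A step down and a step right now cancel.\<close>
    have "L (i + 1) ((j + 1) mod n) = L i j" if "i + 1 < n" "j < n" for i j
    proof (rule eq)
      show "int n dvd t * (int (i + 1) - int i) + s * (int ((j + 1) mod n) - int j)"
        using dvd_mult[OF wrap[of j], of "- s"] by (simp add: t algebra_simps)
    qed (use that in auto)
    then show ?thesis unfolding right_cyclic_def by blast
  qed
qed

end
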